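(* Let $m\ge1$. For any probability vector $\omega=(w_1,\ldots,w_m)$ and any matrices $A_1,\ldots,A_m\in\mathrm{UT}_2$, $$\lim_{p\to 0} G(\omega;A_1^{p},\ldots,A_m^{p})^{1/p}=LE(\omega;A_1,\ldots,A_m),$$ where $p$ ranges over nonzero real numbers, $G$ denotes the Karcher mean on $\mathrm{UT}_2$, and $LE(\omega;A_1,\ldots,A_m)=\exp\left(\sum_{i=1}^m w_i\log(A_i)\right)$ is the log-Euclidean mean.
   Context: $\mathrm{UT}_2$ is the group of $2\times 2$ real upper triangular matrices with positive diagonal entries. A probability vector has nonnegative entries summing to $1$. For $A\in\mathrm{UT}_2$, $\log A$ is the principal logarithm (the unique real upper triangular matrix $L$ with $\exp L=A$), and $A^{p}=\exp(p\log A)$ for $p\in\mathbb{R}$. The Karcher mean $G(\omega;B_1,\ldots,B_m)$ of $B_1,\ldots,B_m\in\mathrm{UT}_2$ is the solution $X\in\mathrm{UT}_2$ of $\sum_i w_i\log(X^{-1}B_i)=0$; on $\mathrm{UT}_2$ it exists and is unique for all inputs. *)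

theory Defs
  imports "HOL-Analysis.Analysis"
begin

definition upper_triangular2 :: "real^2^2 \<Rightarrow> bool" where
  "upper_triangular2 A \<longleftrightarrow> A $ 2 $ 1 = 0"

definition UT2 :: "(real^2^2) set" where
  "UT2 = {A. upper_triangular2 A \<and> A $ 1 $ 1 > 0 \<and> A $ 2 $ 2 > 0}"

(* The library product, power and unit of the type of vectors of vectors are entrywise,
   hence the iterated matrix product here instead of the class operation. *)
definition matrix_exp :: "real^2^2 \<Rightarrow> real^2^2" where
  "matrix_exp A = (\<Sum>n. (((**) A ^^ n) (mat 1)) /\<^sub>R fact n)"

(* Meaningful for arguments in UT2 only, as are the real powers below. *)
definition matrix_log :: "real^2^2 \<Rightarrow> real^2^2" where
  "matrix_log A = (THE L. upper_triangular2 L \<and> matrix_exp L = A)"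

definition matrix_powr :: "real^2^2 \<Rightarrow> real \<Rightarrow> real^2^2" where
  "matrix_powr A p = matrix_exp (p *\<^sub>R matrix_log A)"

(* Families of m weights and m matrices are functions on nat, only used on {1..m}. *)
definition karcher_mean :: "nat \<Rightarrow> (nat \<Rightarrow> real) \<Rightarrow> (nat \<Rightarrow> real^2^2) \<Rightarrow> real^2^2" where
  "karcher_mean m w B =
     (THE X. X \<in> UT2 \<and> (\<Sum>i=1..m. w i *\<^sub>R matrix_log (matrix_inv X ** B i)) = 0)"

definition log_euclidean_mean :: "nat \<Rightarrow> (nat \<Rightarrow> real) \<Rightarrow> (nat \<Rightarrow> real^2^2) \<Rightarrow> real^2^2" where
  "log_euclidean_mean m w A = matrix_exp (\<Sum>i=1..m. w i *\<^sub>R matrix_log (A i))"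

end

theory Submission
  imports Defs
begin

text \<open>In the coordinates of the logarithm everything on UT2 is explicit: the exponential of an
  upper triangular matrix has as upper right entry the original one times the divided difference
  of exp at the diagonal entries. Hence the Karcher equation fixes the diagonal of its solution
  and is linear in the remaining entry. Since the divided differences at \<open>p * a\<close>, \<open>p * d\<close>
  tend to 1 as \<open>p\<close> tends to 0, the upper right entry of the rescaled logarithm of the Karcher
  mean tends to the weighted arithmetic mean of those of the logarithms.\<close>

definition tri :: "real \<Rightarrow> real \<Rightarrow> real \<Rightarrow> real^2^2" where
  "tri a b d = vector [vector [a, b], vector [0, d]]"

text \<open>The confluent value \<open>exp a\<close> is the limit for d tending to a, which lets
  \<open>matrix_exp_tri\<close> hold without a case distinction.\<close>

definition exp_dd :: "real \<Rightarrow> real \<Rightarrow> real" where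
  "exp_dd a d = (if a = d then exp a else (exp a - exp d) / (a - d))"

lemma tri_nth [simp]:
  "tri a b d $ 1 $ 1 = a" "tri a b d $ 1 $ 2 = b" "tri a b d $ 2 $ 1 = 0" "tri a b d $ 2 $ 2 = d"
  by (simp_all add: tri_def)

lemma mat2_eq_iff:
  fixes A B :: "'a^2^2"
  shows "A = B \<longleftrightarrow> A$1$1 = B$1$1 \<and> A$1$2 = B$1$2 \<and> A$2$1 = B$2$1 \<and> A$2$2 = B$2$2"
  by (auto simp: vec_eq_iff forall_2)

lemma tri_eq_iff [simp]: "tri a b d = tri a' b' d' \<longleftrightarrow> a = a' \<and> b = b' \<and> d = d'"
  by (auto simp: mat2_eq_iff)

lemma tri_eq_0_iff: "tri a b d = 0 \<longleftrightarrow> a = 0 \<and> b = 0 \<and> d = 0"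
  by (auto simp: mat2_eq_iff)

lemma upper_triangular2_tri [simp]: "upper_triangular2 (tri a b d)"
  by (simp add: upper_triangular2_def)

lemma upper_triangular2E:
  assumes "upper_triangular2 A"
  obtains a b d where "A = tri a b d"
  using assms that[of "A$1$1" "A$1$2" "A$2$2"]
  by (auto simp: upper_triangular2_def mat2_eq_iff)

text \<open>With the positive diagonal written as exponentials, logarithms, powers and quotients act
  linearly on the exponents.\<close>

lemma UT2E:
  assumes "A \<in> UT2"
  obtains s y t where "A = tri (exp s) y (exp t)"
  using assms that[of "ln (A$1$1)" "A$1$2" "ln (A$2$2)"]
  by (auto simp: UT2_def upper_triangular2_def mat2_eq_iff)

lemma tri_exp_in_UT2 [simp]: "tri (exp s) y (exp t) \<in> UT2"
  by (simp add: UT2_def)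

lemma tri_mult: "tri a b d ** tri a' b' d' = tri (a * a') (a * b' + b * d') (d * d')"
  by (simp add: mat2_eq_iff matrix_matrix_mult_def sum_2)

lemma mat_1_eq_tri: "mat 1 = tri 1 0 1"
  by (simp add: mat2_eq_iff mat_def)

lemma scaleR_tri: "c *\<^sub>R tri a b d = tri (c * a) (c * b) (c * d)"
  by (simp add: mat2_eq_iff)

lemma sum_tri:
  "(\<Sum>i\<in>I. tri (a i) (b i) (d i)) = tri (\<Sum>i\<in>I. a i) (\<Sum>i\<in>I. b i) (\<Sum>i\<in>I. d i)"
  by (simp add: mat2_eq_iff sum_component)

lemma tendsto_tri:
  assumes "(a \<longlongrightarrow> a') F" "(b \<longlongrightarrow> b') F" "(d \<longlongrightarrow> d') F"
  shows "((\<lambda>x. tri (a x) (b x) (d x)) \<longlongrightarrow> tri a' b' d') F"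
proof (intro vec_tendstoI)
  show "((\<lambda>x. tri (a x) (b x) (d x) $ i $ j) \<longlongrightarrow> tri a' b' d' $ i $ j) F" for i j
    using assms exhaust_2[of i] exhaust_2[of j] by auto
qed

lemma sums_tri:
  assumes "a sums a'" "b sums b'" "d sums d'"
  shows "(\<lambda>n. tri (a n) (b n) (d n)) sums tri a' b' d'"
  using assms unfolding sums_def sum_tri by (rule tendsto_tri)

text \<open>As \<open>exp\<close> is strictly increasing, numerator and denominator have the same
  sign. This makes the exponential injective on upper triangular matrices.\<close>

lemma exp_dd_pos: "exp_dd a d > 0"
  by (cases a d rule: linorder_cases) (auto simp: exp_dd_def divide_neg_neg)

lemma exp_dd_neq_0 [simp]: "exp_dd a d \<noteq> 0"
  using exp_dd_pos[of a d] by simp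

lemma exp_dd_scaled_tendsto_1: "((\<lambda>p. exp_dd (p * a) (p * d)) \<longlongrightarrow> 1) (at 0)"
proof (cases "a = d")
  case True
  have "((\<lambda>p. exp (p * d)) \<longlongrightarrow> exp (0 * d)) (at 0)"
    by (intro tendsto_intros)
  with True show ?thesis by (simp add: exp_dd_def)
next
  case False
  \<comment> \<open>This function vanishes at 0, so its difference quotient there is just its value
    divided by p.\<close>
  have "((\<lambda>p. exp (p * a) - exp (p * d)) has_real_derivative a - d) (at 0)"
    by (auto intro!: derivative_eq_intros)
  then have "((\<lambda>p. (exp (p * a) - exp (p * d)) / p) \<longlongrightarrow> a - d) (at 0)"
    by (simp add: DERIV_def)
  then have "((\<lambda>p. (exp (p * a) - exp (p * d)) / p / (a - d)) \<longlongrightarrow> (a - d) / (a - d)) (at 0)"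
    using False by (intro tendsto_intros) auto
  then have "((\<lambda>p. (exp (p * a) - exp (p * d)) / p / (a - d)) \<longlongrightarrow> 1) (at 0)"
    using False by simp
  moreover have "\<forall>\<^sub>F p in at 0.
      (exp (p * a) - exp (p * d)) / p / (a - d) = exp_dd (p * a) (p * d)"
    using False by (auto simp: eventually_at_filter exp_dd_def right_diff_distrib)
  ultimately show ?thesis by (rule Lim_transform_eventually)
qed

text \<open>The upper right entry is b times the divided difference of the n-th power function at a
  and d. For n = 0 the factor \<open>of_nat n\<close> annihilates the truncated exponent.\<close>

lemma tri_power:
  "((**) (tri a b d) ^^ n) (mat 1) =
     tri (a ^ n) (b * (if a = d then of_nat n * a ^ (n - 1) else (a ^ n - d ^ n) / (a - d))) (d ^ n)"
proof (induction n)
  case 0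
  then show ?case by (simp add: mat_1_eq_tri)
next
  case (Suc n)
  show ?case
  proof (cases "a = d")
    case True
    then show ?thesis
      using Suc by (cases n) (auto simp: tri_mult algebra_simps)
  next
    case False
    then show ?thesis
      using Suc by (auto simp: tri_mult divide_simps) (simp add: algebra_simps)
  qed
qed

text \<open>Divided differences are linear, so those of the terms of the exponential series add up
  to that of \<open>exp\<close>.\<close>

lemma matrix_exp_tri: "matrix_exp (tri a b d) = tri (exp a) (b * exp_dd a d) (exp d)"
proof -
  have e: "(\<lambda>n. x ^ n / fact n) sums exp x" for x :: real
    using exp_converges[of x] by (simp add: field_simps)
  have off: "(\<lambda>n. b * (if a = d then of_nat n * a ^ (n - 1) else (a ^ n - d ^ n) / (a - d)) / fact n)
      sums (b * exp_dd a d)"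
  proof (cases "a = d")
    case True
    \<comment> \<open>The term at index 0 vanishes; after shifting the index, the factor
      \<open>Suc n\<close> cancels against the factorial.\<close>
    have "(\<lambda>n. of_nat (Suc n) * a ^ (Suc n - 1) / fact (Suc n)) sums exp a"
      using e[of a] by (simp add: field_simps del: of_nat_Suc)
    then have "(\<lambda>n. of_nat n * a ^ (n - 1) / fact n) sums exp a"
      by (subst (asm) sums_Suc_iff) simp
    from sums_mult[OF this, of b] True show ?thesis
      by (simp add: exp_dd_def)
  next
    case False
    have "(\<lambda>n. b * ((a ^ n / fact n - d ^ n / fact n) / (a - d))) sums (b * ((exp a - exp d) / (a - d)))"
      by (intro sums_mult sums_divide sums_diff e)
    with False show ?thesis
      by (simp add: exp_dd_def diff_divide_distrib right_diff_distrib mult_ac)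
  qed
  have "(\<lambda>n. ((**) (tri a b d) ^^ n) (mat 1) /\<^sub>R fact n) sums
      tri (exp a) (b * exp_dd a d) (exp d)"
    using sums_tri[OF e off e] by (simp add: tri_power scaleR_tri divide_inverse_commute)
  then show ?thesis
    by (simp add: matrix_exp_def sums_iff)
qed

text \<open>The diagonal entries determine s and t by injectivity of the real exponential, and the
  remaining entry is found by dividing by the nonzero \<open>exp_dd s t\<close>.\<close>

lemma matrix_log_tri: "matrix_log (tri (exp s) y (exp t)) = tri s (y / exp_dd s t) t"
  unfolding matrix_log_def
  by (rule the_equality) (auto simp: matrix_exp_tri elim!: upper_triangular2E)

lemma matrix_powr_tri:
  "matrix_powr (tri (exp s) y (exp t)) p =
     tri (exp (p * s)) (p * (y / exp_dd s t) * exp_dd (p * s) (p * t)) (exp (p * t))"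
  by (simp add: matrix_powr_def matrix_log_tri scaleR_tri matrix_exp_tri)

lemma matrix_inv_tri:
  assumes "a \<noteq> 0" "d \<noteq> 0"
  shows "matrix_inv (tri a b d) = tri (1 / a) (- b / (a * d)) (1 / d)"
proof -
  let ?A = "tri a b d" and ?B = "tri (1 / a) (- b / (a * d)) (1 / d)"
  have *: "?A ** ?B = mat 1" "?B ** ?A = mat 1"
    using assms by (simp_all add: tri_mult mat_1_eq_tri field_simps)
  then show ?thesis
    unfolding matrix_inv_def
    \<comment> \<open>\<open>matrix_inv\<close> chooses some two-sided inverse, and any two of these
      agree by associativity.\<close>
    by (intro some_equality) (auto, metis matrix_mul_assoc matrix_mul_lid matrix_mul_rid)
qed

lemma matrix_log_quotient_tri:
  "matrix_log (matrix_inv (tri (exp s) y (exp t)) ** tri (exp a) b (exp d)) =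
     tri (a - s) ((b - y * exp (d - t)) / exp s / exp_dd (a - s) (d - t)) (d - t)"
proof -
  have "matrix_inv (tri (exp s) y (exp t)) ** tri (exp a) b (exp d) =
      tri (exp (a - s)) ((b - y * exp (d - t)) / exp s) (exp (d - t))"
    by (simp add: matrix_inv_tri tri_mult exp_diff field_simps)
  then show ?thesis by (simp add: matrix_log_tri)
qed

lemma karcher_mean_cong:
  assumes "\<And>i. i \<in> {1..m} \<Longrightarrow> B i = B' i"
  shows "karcher_mean m w B = karcher_mean m w B'"
proof -
  have "(\<Sum>i=1..m. w i *\<^sub>R matrix_log (matrix_inv X ** B i)) =
      (\<Sum>i=1..m. w i *\<^sub>R matrix_log (matrix_inv X ** B' i))" for X
    using assms by (intro sum.cong) auto
  then show ?thesis by (simp add: karcher_mean_def)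
qed

lemma karcher_mean_tri:
  fixes w a b d :: "nat \<Rightarrow> real" and m :: nat
  defines "s \<equiv> \<Sum>i=1..m. w i * a i" and "t \<equiv> \<Sum>i=1..m. w i * d i"
  assumes w: "\<And>i. i \<in> {1..m} \<Longrightarrow> w i \<ge> 0" "(\<Sum>i=1..m. w i) = 1"
  shows "karcher_mean m w (\<lambda>i. tri (exp (a i)) (b i) (exp (d i))) =
    tri (exp s)
      ((\<Sum>i=1..m. w i * b i / exp_dd (a i - s) (d i - t)) /
       (\<Sum>i=1..m. w i * exp (d i - t) / exp_dd (a i - s) (d i - t)))
      (exp t)"
    (is "_ = tri _ (?N / ?D) _")
proof -
  \<comment> \<open>Since the weights sum to 1, one of them is positive, which makes the denominator
    strictly positive.\<close>
  obtain j where j: "j \<in> {1..m}" "w j > 0"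
    using w by (metis order_le_less sum.neutral zero_neq_one)
  have "?D > 0"
    using j w(1)[of j] w(1)
    by (intro sum_pos2[of _ j])
      (auto intro!: divide_pos_pos divide_nonneg_pos mult_pos_pos exp_dd_pos)
  \<comment> \<open>The equivalence yields existence and uniqueness of the Karcher mean at
    once.\<close>
  have eqn: "(\<Sum>i=1..m. w i *\<^sub>R matrix_log (matrix_inv (tri (exp s') y (exp t')) **
        tri (exp (a i)) (b i) (exp (d i)))) = 0 \<longleftrightarrow> s' = s \<and> t' = t \<and> y = ?N / ?D" for s' y t'
  proof -
    have "(\<Sum>i=1..m. w i * (a i - s')) = s - s'" "(\<Sum>i=1..m. w i * (d i - t')) = t - t'"
      using w(2) by (simp_all add: s_def t_def right_diff_distrib sum_subtractf
        flip: sum_distrib_right)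
    \<comment> \<open>The diagonal equations force s' = s and t' = t, so the upper right one is
      needed only at these values, where it is linear in y.\<close>
    moreover have "(\<Sum>i=1..m. w i * ((b i - y * exp (d i - t)) / exp s /
        exp_dd (a i - s) (d i - t))) = (?N - y * ?D) / exp s"
      by (simp add: sum_distrib_left sum_divide_distrib diff_divide_distrib right_diff_distrib
        sum_subtractf mult_ac)
    moreover have "(?N - y * ?D) / exp s = 0 \<longleftrightarrow> y = ?N / ?D"
      using \<open>?D > 0\<close> by (auto simp: field_simps)
    ultimately show ?thesis
      by (auto simp: matrix_log_quotient_tri scaleR_tri sum_tri tri_eq_0_iff)
  qed
  show ?thesis
    unfolding karcher_mean_def
    by (rule the_equality) (auto simp: eqn simp del: One_nat_def elim!: UT2E)
qed

theorem theorem3p3: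
  fixes m :: nat and w :: "nat \<Rightarrow> real" and A :: "nat \<Rightarrow> real^2^2"
  assumes "m \<ge> 1"
    and "\<And>i. i \<in> {1..m} \<Longrightarrow> w i \<ge> 0"
    and "(\<Sum>i=1..m. w i) = 1"
    and "\<And>i. i \<in> {1..m} \<Longrightarrow> A i \<in> UT2"
  shows "((\<lambda>p::real. matrix_powr (karcher_mean m w (\<lambda>i. matrix_powr (A i) p)) (1 / p))
            \<longlongrightarrow> log_euclidean_mean m w A) (at 0)"
proof -
  have "\<forall>i\<in>{1..m}. \<exists>a y d. A i = tri (exp a) y (exp d)"
    using assms(4) by (metis UT2E)
  then obtain a y d where A: "\<And>i. i \<in> {1..m} \<Longrightarrow> A i = tri (exp (a i)) (y i) (exp (d i))"
    by metis
  \<comment> \<open>\<open>b i\<close> is the upper right entry of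
    \<open>matrix_log (A i)\<close>.\<close>
  define b where "b i = y i / exp_dd (a i) (d i)" for i
  define s t u where "s = (\<Sum>i=1..m. w i * a i)" and "t = (\<Sum>i=1..m. w i * d i)"
    and "u = (\<Sum>i=1..m. w i * b i)"
  define r where "r p i = exp_dd (p * (a i - s)) (p * (d i - t))" for p i
  define N where "N p = (\<Sum>i=1..m. w i * (b i * exp_dd (p * a i) (p * d i)) / r p i)" for p
  define D where "D p = (\<Sum>i=1..m. w i * exp (p * (d i - t)) / r p i)" for p
  \<comment> \<open>For p \<noteq> 0 this is the upper right entry of 1/p times the logarithm of the
    Karcher mean.\<close>
  define c where "c p = N p / D p / exp_dd (p * s) (p * t)" for p

  \<comment> \<open>Each power contributes a factor p to the upper right entry. Pulled out of the
    quotient, it later cancels against the exponent 1/p, and no indeterminate form is left.\<close>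
  have K: "karcher_mean m w (\<lambda>i. matrix_powr (A i) p) =
      tri (exp (p * s)) (p * (N p / D p)) (exp (p * t))" for p
  proof -
    have "karcher_mean m w (\<lambda>i. matrix_powr (A i) p) =
        karcher_mean m w (\<lambda>i. tri (exp (p * a i)) (p * b i * exp_dd (p * a i) (p * d i))
          (exp (p * d i)))"
      by (rule karcher_mean_cong) (simp add: A matrix_powr_tri b_def)
    moreover have "(\<Sum>i=1..m. w i * (p * a i)) = p * s" "(\<Sum>i=1..m. w i * (p * d i)) = p * t"
      by (simp_all add: s_def t_def sum_distrib_left mult_ac)
    moreover have "(\<Sum>i=1..m. w i * (p * b i * exp_dd (p * a i) (p * d i)) / r p i) = p * N p"
      by (simp add: N_def sum_distrib_left mult_ac)
    ultimately show ?thesis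
      using karcher_mean_tri[OF assms(2,3), where a = "\<lambda>i. p * a i" and d = "\<lambda>i. p * d i"]
      by (simp add: D_def r_def flip: right_diff_distrib)
  qed
  \<comment> \<open>For every p \<noteq> 0 the diagonal already equals that of the log-Euclidean
    mean, so only the limit of \<open>c\<close> remains.\<close>
  have powr: "matrix_powr (karcher_mean m w (\<lambda>i. matrix_powr (A i) p)) (1 / p) =
      tri (exp s) (c p * exp_dd s t) (exp t)" if "p \<noteq> 0" for p
    using that by (simp add: K matrix_powr_tri c_def)
  have LE: "log_euclidean_mean m w A = tri (exp s) (u * exp_dd s t) (exp t)"
  proof -
    have "(\<Sum>i=1..m. w i *\<^sub>R matrix_log (A i)) = (\<Sum>i=1..m. tri (w i * a i) (w i * b i) (w i * d i))"
      by (rule sum.cong) (simp_all add: A matrix_log_tri scaleR_tri b_def)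
    then show ?thesis
      by (simp add: log_euclidean_mean_def sum_tri matrix_exp_tri s_def t_def u_def)
  qed

  have "(N \<longlongrightarrow> (\<Sum>i=1..m. w i * (b i * 1) / 1)) (at 0)"
    unfolding N_def r_def by (intro tendsto_intros exp_dd_scaled_tendsto_1) simp
  then have N: "(N \<longlongrightarrow> u) (at 0)"
    by (simp add: u_def)
  have "(D \<longlongrightarrow> (\<Sum>i=1..m. w i * exp (0 * (d i - t)) / 1)) (at 0)"
    unfolding D_def r_def by (intro tendsto_intros exp_dd_scaled_tendsto_1) simp
  then have D: "(D \<longlongrightarrow> 1) (at 0)"
    by (simp add: assms(3)[simplified])
  have "(c \<longlongrightarrow> u / 1 / 1) (at 0)"
    unfolding c_def by (intro tendsto_divide N D exp_dd_scaled_tendsto_1) simp_all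
  then have "((\<lambda>p. tri (exp s) (c p * exp_dd s t) (exp t)) \<longlongrightarrow> log_euclidean_mean m w A) (at 0)"
    unfolding LE by (intro tendsto_tri tendsto_intros) simp
  \<comment> \<open>The filter \<open>at 0\<close> omits p = 0, the one point not covered by
    \<open>powr\<close>.\<close>
  then show ?thesis
    by (rule Lim_transform_eventually) (simp add: eventually_at_filter powr)
qed

end
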